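(* Let $(\lambda_2,\ldots,\lambda_n)$ be any list of complex numbers which is closed under complex conjugation, with $\lambda_2\ge\cdots\ge\lambda_p$ real, where $n-p-1\le p\le n$, and let $\lambda_{p+1},\ldots,\lambda_n$ be non-real, indexed so that $\lambda_{p+1},\ldots,\lambda_{\frac{n+p}{2}}$ contains exactly one member of each complex conjugate pair, with real and imaginary parts $x_i=\Re(\lambda_i)$ and $y_i=\Im(\lambda_i)$ for $i=p+1,\ldots,\frac{n+p}{2}$. Let $$w=\min\{\pm\lambda_2,\ldots,\pm\lambda_p,\ \pm x_{p+1},\pm y_{p+1},\ldots,\pm x_{\frac{n+p}{2}},\pm y_{\frac{n+p}{2}}\}.$$ Then there exists a least real number $\lambda_0$ with $$\max_{2\le j\le n}|\lambda_j|\le\lambda_0\le (n+1)|w|$$ such that the list of complex numbers $(\lambda_1;\lambda_2,\ldots,\lambda_n)$ is realizable by an $n\times n$ nonnegative generalized doubly stochastic matrix if and only if $\lambda_1\ge\lambda_0$.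
   Context: Lists are considered with multiplicity. A real $n\times n$ matrix is generalized doubly stochastic if there is a real number $r\ge 0$ such that every row sum and every column sum equals $r$; it is nonnegative if all its entries are nonnegative. A list $(\lambda_1;\lambda_2,\ldots,\lambda_n)$, with a semicolon after the first entry, is realizable by a nonnegative matrix $A$ if it is the spectrum of $A$ (eigenvalues counted with multiplicity) and $\lambda_1$ is the Perron eigenvalue of $A$ (the nonnegative eigenvalue that is at least the modulus of every other eigenvalue). The notation $\min\{\pm a,\pm b,\ldots\}$ means the minimum of the set containing $a,-a,b,-b,\ldots$. *)

theory Defs
  imports
    "HOL-Computational_Algebra.Computational_Algebra"
    "Jordan_Normal_Form.Char_Poly"
begin

definition nonnegative_mat :: "real mat \<Rightarrow> bool" where
  "nonnegative_mat A \<longleftrightarrow> (\<forall>i < dim_row A. \<forall>j < dim_col A. 0 \<le> A $$ (i, j))"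

definition gen_doubly_stochastic :: "real mat \<Rightarrow> bool" where
  "gen_doubly_stochastic A \<longleftrightarrow>
     square_mat A \<and>
     (\<exists>r \<ge> 0.
        (\<forall>i < dim_row A. (\<Sum>j < dim_col A. A $$ (i, j)) = r) \<and>
        (\<forall>j < dim_col A. (\<Sum>i < dim_row A. A $$ (i, j)) = r))"

abbreviation complex_mat :: "real mat \<Rightarrow> complex mat" where
  "complex_mat A \<equiv> map_mat complex_of_real A"

text \<open>The complex eigenvalues of a real square matrix, with algebraic multiplicity
  (the library constant \<open>spectrum\<close> is only a set).\<close>

definition spectrum_mset :: "real mat \<Rightarrow> complex multiset" where
  "spectrum_mset A = proots (char_poly (complex_mat A))"

definition perron_eigenvalue :: "real mat \<Rightarrow> real \<Rightarrow> bool" where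
  "perron_eigenvalue A r \<longleftrightarrow>
     0 \<le> r \<and> eigenvalue (complex_mat A) (complex_of_real r) \<and>
     (\<forall>\<mu>. eigenvalue (complex_mat A) \<mu> \<longrightarrow> cmod \<mu> \<le> r)"

text \<open>\<open>realizes A l1 ls\<close>: the list \<open>(l1; ls)\<close>, with distinguished first entry \<open>l1\<close>, is
  realizable by the nonnegative matrix \<open>A\<close>. A Perron eigenvalue is a real number, so \<open>l1\<close> is real.\<close>

definition realizes :: "real mat \<Rightarrow> real \<Rightarrow> complex list \<Rightarrow> bool" where
  "realizes A l1 ls \<longleftrightarrow>
     square_mat A \<and> nonnegative_mat A \<and>
     spectrum_mset A = mset (complex_of_real l1 # ls) \<and>
     perron_eigenvalue A l1"

end

theory Submission
  imports Defs "HOL-Analysis.Function_Topology"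
begin

text \<open>Let \<open>q\<^sub>0 = e / sqrt n, q\<^sub>1, \<dots>\<close> be an orthonormal basis of real n-space. Attaching the real eigenvalues to
  single vectors \<open>q\<^sub>k\<close> and every conjugate pair \<open>x \<plusminus> i y\<close> to a rotation-scaling block on two vectors
  \<open>u, v\<close> gives a real normal matrix with constant row and column sums \<open>\<lambda>\<^sub>1\<close> and the prescribed spectrum.
  Off the \<open>e\<close>-direction its entries are at least \<open>-\<bar>w\<bar>\<close> times the largest value over i of
  \<open>\<Sum> q\<^sub>k(i)\<^sup>2 + \<Sum> (\<bar>u(i)\<bar> + \<bar>v(i)\<bar>)\<^sup>2\<close>. If the two vectors of each pair have disjoint supports, that value
  is \<open>1 - 1/n\<close>; the only other case is \<open>n = 3\<close> with one pair, where it is at most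
  \<open>2 (1 - 1/3) = 1 + 1/3\<close>. Hence \<open>\<lambda>\<^sub>1 = (n + 1) \<bar>w\<bar>\<close> makes the matrix nonnegative. Adding a
  constant matrix moves only \<open>\<lambda>\<^sub>1\<close>, so the realizable values form an up-set, and it
  has a least element by compactness.\<close>

section \<open>The parity-adapted Helmert basis\<close>

lemma sum_parity:
  "(\<Sum>i<n. if even i then a else b) = real ((n + 1) div 2) * a + real (n div 2) * (b::real)"
proof (induction n)
  case (Suc n)
  then show ?case by (cases "even n") (auto simp: algebra_simps elim!: evenE oddE)
qed simp

lemma sum_same_parity_below:
  "(\<Sum>i<k. if i mod 2 = k mod 2 then c else 0) = real (k div 2) * (c::real)"
proof (cases "even k")
  case True
  then have "(\<Sum>i<k. if i mod 2 = k mod 2 then c else 0) = (\<Sum>i<k. if even i then c else 0)"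
    by (intro sum.cong) (auto simp: even_iff_mod_2_eq_zero)
  then show ?thesis using True by (simp add: sum_parity)
next
  case False
  then have "(\<Sum>i<k. if i mod 2 = k mod 2 then c else 0) = (\<Sum>i<k. if even i then 0 else c)"
    by (intro sum.cong) (auto simp: odd_iff_mod_2_eq_one even_iff_mod_2_eq_zero)
  then show ?thesis by (simp add: sum_parity)
qed

text \<open>The vectors with index \<open>k \<ge> 2\<close> are Helmert vectors supported on the coordinates of the same
  parity as \<open>k\<close>, so that consecutive ones have disjoint supports; the vector with index 1 is constant on
  each parity class.\<close>

definition parity_helmert :: "nat \<Rightarrow> nat \<Rightarrow> nat \<Rightarrow> real" where
  "parity_helmert n k i =
    (if k = 0 then 1 / sqrt (real n)
     else if k = 1 then
       (if even i then real (n div 2) else - real ((n + 1) div 2))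
         / sqrt (real ((n + 1) div 2) * real (n div 2) * real n)
     else if i mod 2 = k mod 2 \<and> i \<le> k then
       (if i < k then 1 else - real (k div 2)) / sqrt (real (k div 2) * (real (k div 2) + 1))
     else 0)"

lemma parity_helmert_0: "parity_helmert n 0 i = 1 / sqrt (real n)"
  by (simp add: parity_helmert_def)

lemma parity_helmert_support:
  "2 \<le> k \<Longrightarrow> parity_helmert n k i \<noteq> 0 \<Longrightarrow> i mod 2 = k mod 2"
  by (auto simp: parity_helmert_def split: if_splits)

text \<open>The vector vanishes beyond index \<open>k\<close> and off the parity class of
  \<open>k\<close>, so only those terms survive. With \<open>g\<close> arbitrary, one formula serves
  both orthogonality and the norm.\<close>

lemma sum_parity_helmert_mult:
  assumes "2 \<le> k" "k < n"
  shows "(\<Sum>i<n. parity_helmert n k i * g i) =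
    ((\<Sum>i<k. if i mod 2 = k mod 2 then g i else 0) - real (k div 2) * g k)
      / sqrt (real (k div 2) * (real (k div 2) + 1))"
proof -
  define s where "s = sqrt (real (k div 2) * (real (k div 2) + 1))"
  have "(\<Sum>i<n. parity_helmert n k i * g i) = (\<Sum>i<Suc k. parity_helmert n k i * g i)"
    using assms by (intro sum.mono_neutral_right) (auto simp: parity_helmert_def)
  also have "\<dots> = (\<Sum>i<k. parity_helmert n k i * g i) + parity_helmert n k k * g k"
    by simp
  also have "(\<Sum>i<k. parity_helmert n k i * g i)
      = (\<Sum>i<k. (if i mod 2 = k mod 2 then g i else 0) / s)"
    using assms by (intro sum.cong) (auto simp: parity_helmert_def s_def)
  also have "parity_helmert n k k * g k = - real (k div 2) * g k / s"
    using assms by (auto simp: parity_helmert_def s_def)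
  finally show ?thesis
    by (simp add: s_def sum_divide_distrib[symmetric] diff_divide_distrib)
qed

text \<open>The \<open>k div 2\<close> equal weights below \<open>k\<close> cancel against the
  weight \<open>- real (k div 2)\<close> at \<open>k\<close> itself.\<close>

lemma sum_parity_helmert_mult_const:
  assumes "2 \<le> k" "k < n" and "\<And>i. i \<le> k \<Longrightarrow> i mod 2 = k mod 2 \<Longrightarrow> g i = c"
  shows "(\<Sum>i<n. parity_helmert n k i * g i) = 0"
proof -
  have "(\<Sum>i<k. if i mod 2 = k mod 2 then g i else 0) = (\<Sum>i<k. if i mod 2 = k mod 2 then c else 0)"
    by (intro sum.cong) (auto simp: assms(3))
  then show ?thesis
    by (simp add: sum_parity_helmert_mult[OF assms(1,2)] sum_same_parity_below assms(3))
qed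

text \<open>For \<open>2 \<le> k\<close> the later vector is constant on the support of the earlier
  one. For \<open>k < 2 \<le> l\<close> the roles swap, since vectors 0 and 1 are constant on each
  parity class. For the pair 0, 1 the weights balance the class sizes.\<close>

lemma parity_helmert_orthogonal:
  assumes "k < l" "l < n"
  shows "(\<Sum>i<n. parity_helmert n k i * parity_helmert n l i) = 0"
proof (cases "2 \<le> k")
  case True
  define c where "c = (if k mod 2 = l mod 2 then 1 else 0) / sqrt (real (l div 2) * (real (l div 2) + 1))"
  show ?thesis
    by (rule sum_parity_helmert_mult_const[where c = c]) (use assms True in \<open>auto simp: parity_helmert_def c_def\<close>)
next
  case False
  show ?thesis
  proof (cases "2 \<le> l")
    case True
    have "parity_helmert n k i = parity_helmert n k l" if "i mod 2 = l mod 2" for i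
    proof -
      have "even i = even l" using that by (simp add: even_iff_mod_2_eq_zero)
      then show ?thesis using False by (auto simp: parity_helmert_def)
    qed
    then have "(\<Sum>i<n. parity_helmert n l i * parity_helmert n k i) = 0"
      by (rule sum_parity_helmert_mult_const[OF True assms(2)])
    then show ?thesis by (simp add: mult.commute)
  next
    case l: False
    with assms have kl: "k = 0" "l = 1" by auto
    define D where "D = sqrt (real ((n + 1) div 2) * real (n div 2) * real n)"
    have "(\<Sum>i<n. parity_helmert n k i * parity_helmert n l i)
        = (\<Sum>i<n. if even i then real (n div 2) / (D * sqrt n) else - real ((n + 1) div 2) / (D * sqrt n))"
      unfolding kl parity_helmert_def D_def[symmetric] by (intro sum.cong) auto
    also have "\<dots> = 0"
      unfolding sum_parity by simp
    finally show ?thesis .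
  qed
qed

lemma parity_helmert_norm:
  assumes "k < n"
  shows "(\<Sum>i<n. (parity_helmert n k i)\<^sup>2) = 1"
proof -
  consider "k = 0" | "k = 1" | "2 \<le> k" by linarith
  then show ?thesis
  proof cases
    case 1
    then show ?thesis using assms by (simp add: parity_helmert_def power_divide)
  next
    case 2
    \<comment> \<open>\<open>A\<close> and \<open>B\<close> count the even and the odd coordinates;
      the squared norm reduces to
      \<open>A * B\<^sup>2 + B * A\<^sup>2 = A * B * (A + B)\<close>.\<close>
    define A where "A = real ((n + 1) div 2)"
    define B where "B = real (n div 2)"
    have "n = (n + 1) div 2 + n div 2" by presburger
    then have n: "real n = A + B" unfolding A_def B_def by (metis of_nat_add)
    have pos: "A > 0" "B > 0" using assms 2 unfolding A_def B_def by auto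
    have "(\<Sum>i<n. (parity_helmert n k i)\<^sup>2) = (\<Sum>i<n. if even i then B\<^sup>2 / (A * B * (A + B)) else A\<^sup>2 / (A * B * (A + B)))"
      using 2 pos unfolding parity_helmert_def n A_def[symmetric] B_def[symmetric]
      by (intro sum.cong) (auto simp: power_divide)
    also have "\<dots> = A * (B\<^sup>2 / (A * B * (A + B))) + B * (A\<^sup>2 / (A * B * (A + B)))"
      unfolding sum_parity A_def B_def ..
    also have "\<dots> = (A * B * (A + B)) / (A * B * (A + B))"
      by (simp add: power2_eq_square add_divide_distrib[symmetric] algebra_simps)
    also have "\<dots> = 1" using pos by simp
    finally show ?thesis .
  next
    case 3
    define K where "K = real (k div 2)"
    define s where "s = sqrt (K * (K + 1))"
    have K: "K > 0" using 3 unfolding K_def by auto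
    then have s: "s > 0" "s * s = K * (K + 1)" unfolding s_def by auto
    have "(\<Sum>i<k. if i mod 2 = k mod 2 then parity_helmert n k i else 0)
        = (\<Sum>i<k. if i mod 2 = k mod 2 then 1 / s else 0)"
      using 3 by (intro sum.cong) (auto simp: parity_helmert_def s_def K_def)
    also have "\<dots> = K * (1 / s)" unfolding sum_same_parity_below K_def ..
    finally have 1: "(\<Sum>i<k. if i mod 2 = k mod 2 then parity_helmert n k i else 0) = K * (1 / s)" .
    have 2: "parity_helmert n k k = - K / s"
      using 3 by (auto simp: parity_helmert_def s_def K_def)
    \<comment> \<open>One factor of the square plays the role of \<open>g\<close> in
      \<open>sum_parity_helmert_mult\<close>.\<close>
    have "(\<Sum>i<n. (parity_helmert n k i)\<^sup>2) = (K * (1 / s) - K * (- K / s)) / s"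
      unfolding power2_eq_square sum_parity_helmert_mult[OF 3 assms] 1 2 K_def s_def ..
    also have "\<dots> = (K * (K + 1)) / (s * s)"
      by (simp add: algebra_simps add_divide_distrib)
    also have "\<dots> = 1" using s K by simp
    finally show ?thesis .
  qed
qed

lemma parity_helmert_orthonormal_rows:
  assumes "k < n" "l < n"
  shows "(\<Sum>i<n. parity_helmert n k i * parity_helmert n l i) = (if k = l then 1 else 0)"
proof -
  consider "k < l" | "k = l" | "l < k" by linarith
  then show ?thesis
  proof cases
    case 3
    then show ?thesis using parity_helmert_orthogonal[OF 3 assms(1)] by (simp add: mult.commute)
  qed (use assms parity_helmert_orthogonal parity_helmert_norm in \<open>auto simp: power2_eq_square\<close>)
qed

definition parity_helmert_mat :: "nat \<Rightarrow> real mat" where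
  "parity_helmert_mat n = mat n n (\<lambda>(k, i). parity_helmert n k i)"

lemma parity_helmert_mat_carrier [simp]: "parity_helmert_mat n \<in> carrier_mat n n"
  by (simp add: parity_helmert_mat_def)

text \<open>A one-sided inverse of a square matrix is two-sided, so orthonormality of the vectors
  also yields their completeness at each pair of coordinates.\<close>

lemma parity_helmert_mat_orthogonal:
  "parity_helmert_mat n * transpose_mat (parity_helmert_mat n) = 1\<^sub>m n"
  "transpose_mat (parity_helmert_mat n) * parity_helmert_mat n = 1\<^sub>m n"
proof -
  show *: "parity_helmert_mat n * transpose_mat (parity_helmert_mat n) = 1\<^sub>m n"
    by (rule eq_matI)
      (auto simp: parity_helmert_mat_def scalar_prod_def parity_helmert_orthonormal_rows
        simp flip: lessThan_atLeast0)
  show "transpose_mat (parity_helmert_mat n) * parity_helmert_mat n = 1\<^sub>m n"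
    by (rule mat_mult_left_right_inverse[OF _ _ *]) auto
qed

lemma parity_helmert_orthonormal_cols:
  assumes "i < n" "j < n"
  shows "(\<Sum>k<n. parity_helmert n k i * parity_helmert n k j) = (if i = j then 1 else 0)"
proof -
  have "(\<Sum>k<n. parity_helmert n k i * parity_helmert n k j)
      = (transpose_mat (parity_helmert_mat n) * parity_helmert_mat n) $$ (i, j)"
    using assms by (simp add: parity_helmert_mat_def scalar_prod_def flip: lessThan_atLeast0)
  then show ?thesis using assms by (simp add: parity_helmert_mat_orthogonal)
qed

lemma sum_parity_helmert:
  assumes "0 < k" "k < n"
  shows "(\<Sum>i<n. parity_helmert n k i) = 0"
proof -
  have "(\<Sum>i<n. parity_helmert n k i) / sqrt n = 0"
    using parity_helmert_orthogonal[OF assms] by (simp add: parity_helmert_0 sum_divide_distrib)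
  then show ?thesis using assms by simp
qed

section \<open>Constant line sums and the complement of the all-ones vector\<close>

text \<open>Unlike in \<open>gen_doubly_stochastic\<close>, the common sum is an explicit parameter
  of arbitrary sign, so that it can be shifted and compared with the Perron eigenvalue.\<close>

definition equal_sums_mat :: "nat \<Rightarrow> real mat \<Rightarrow> real \<Rightarrow> bool" where
  "equal_sums_mat n M r \<longleftrightarrow> M \<in> carrier_mat n n \<and>
     (\<forall>i<n. (\<Sum>j<n. M $$ (i, j)) = r) \<and> (\<forall>j<n. (\<Sum>i<n. M $$ (i, j)) = r)"

text \<open>The compression of \<open>M\<close> to the hyperplane orthogonal to the all-ones vector,
  in Helmert coordinates; the shift by \<open>Suc\<close> skips the constant vector.\<close>

definition helmert_compression :: "nat \<Rightarrow> real mat \<Rightarrow> real mat" where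
  "helmert_compression n M = mat (n - 1) (n - 1)
     (\<lambda>(k, l). \<Sum>i<n. \<Sum>j<n. parity_helmert n (Suc k) i * M $$ (i, j) * parity_helmert n (Suc l) j)"

text \<open>Constant row sums make the all-ones vector an eigenvector for \<open>r\<close>. In the
  Helmert basis the matrix is therefore block upper triangular, with corner \<open>r\<close> and the
  compression as the other diagonal block.\<close>

lemma char_poly_equal_sums:
  assumes "equal_sums_mat n M r" "0 < n"
  shows "char_poly M = [:- r, 1:] * char_poly (helmert_compression n M)"
proof -
  let ?Q = "parity_helmert_mat n" and ?q = "parity_helmert n"
  have M: "M \<in> carrier_mat n n"
    and row: "\<And>i. i < n \<Longrightarrow> (\<Sum>j<n. M $$ (i, j)) = r"
    and col: "\<And>j. j < n \<Longrightarrow> (\<Sum>i<n. M $$ (i, j)) = r"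
    using assms by (auto simp: equal_sums_mat_def)
  define N where "N = ?Q * M * transpose_mat ?Q"
  have "similar_mat N M"
    by (rule similar_matI[of _ _ ?Q "transpose_mat ?Q" n])
      (use M in \<open>auto simp: N_def parity_helmert_mat_orthogonal intro!: mult_carrier_mat\<close>)
  then have cp: "char_poly M = char_poly N" using char_poly_similar by metis
  have N_eq: "N $$ (k, l) = (\<Sum>i<n. \<Sum>j<n. ?q k i * M $$ (i, j) * ?q l j)" if "k < n" "l < n" for k l
  proof -
    have "N $$ (k, l) = (\<Sum>j<n. (\<Sum>i<n. ?q k i * M $$ (i, j)) * ?q l j)"
      using that M by (simp add: N_def parity_helmert_mat_def scalar_prod_def flip: lessThan_atLeast0)
    also have "\<dots> = (\<Sum>i<n. \<Sum>j<n. ?q k i * M $$ (i, j) * ?q l j)"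
      by (subst sum.swap) (simp add: sum_distrib_right)
    finally show ?thesis .
  qed
  have N_col: "N $$ (k, 0) = (if k = 0 then r else 0)" if "k < n" for k
  proof -
    have "N $$ (k, 0) = (\<Sum>i<n. ?q k i * (\<Sum>j<n. M $$ (i, j)) * ?q 0 0)"
      using N_eq[OF that assms(2)] by (simp add: parity_helmert_0 sum_distrib_left sum_divide_distrib)
    also have "\<dots> = r * (\<Sum>i<n. ?q k i * ?q 0 i)"
      by (simp add: row sum_distrib_left parity_helmert_0 mult_ac)
    also have "\<dots> = (if k = 0 then r else 0)"
      using that assms by (simp add: parity_helmert_orthonormal_rows)
    finally show ?thesis .
  qed
  have split: "N = four_block_mat (mat 1 1 (\<lambda>_. r)) (mat 1 (n - 1) (\<lambda>(k, l). N $$ (k, Suc l)))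
      (0\<^sub>m (n - 1) 1) (helmert_compression n M)" (is "_ = ?F")
  proof (rule eq_matI)
    fix i j assume "i < dim_row ?F" "j < dim_col ?F"
    then have ij: "i < n" "j < n" using assms by (auto simp: helmert_compression_def)
    show "N $$ (i, j) = ?F $$ (i, j)"
      using ij N_col[of i] by (cases j; cases i) (auto simp: helmert_compression_def N_eq)
  qed (use assms M in \<open>auto simp: N_def helmert_compression_def parity_helmert_mat_def\<close>)
  have "char_poly N = char_poly (mat 1 1 (\<lambda>_. r)) * char_poly (helmert_compression n M)"
    by (subst split, rule char_poly_four_block_zeros_col) (auto simp: helmert_compression_def)
  also have "char_poly (mat 1 1 (\<lambda>_. r)) = [:- r, 1:]"
    by (subst char_poly_upper_triangular[of _ 1]) (auto simp: diag_mat_def)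
  finally show ?thesis using cp by simp
qed

text \<open>The added matrix is a multiple of the all-ones matrix, which annihilates every vector
  with zero coordinate sum.\<close>

lemma helmert_compression_add_const:
  assumes "M \<in> carrier_mat n n"
  shows "helmert_compression n (M + mat n n (\<lambda>_. c)) = helmert_compression n M"
proof (rule eq_matI)
  fix k l assume "k < dim_row (helmert_compression n M)" "l < dim_col (helmert_compression n M)"
  then have kl: "Suc k < n" "Suc l < n" by (auto simp: helmert_compression_def)
  have z: "(\<Sum>j<n. parity_helmert n (Suc k) i * c * parity_helmert n (Suc l) j) = 0" for i
    using sum_parity_helmert[of "Suc l" n] kl by (simp flip: sum_distrib_left)
  show "helmert_compression n (M + mat n n (\<lambda>_. c)) $$ (k, l) = helmert_compression n M $$ (k, l)"
    using kl assms z by (simp add: helmert_compression_def algebra_simps sum.distrib)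
qed (auto simp: helmert_compression_def)

lemma proots_prod_linear: "proots (\<Prod>x\<leftarrow>xs. [:- x, 1:]) = mset (xs :: complex list)"
proof (induction xs)
  case (Cons a xs)
  have "(\<Prod>x\<leftarrow>xs. [:- x, 1:]) \<noteq> 0" by (auto simp: prod_list_zero_iff)
  then show ?case using Cons by (simp add: proots_mult del: mult_pCons_left)
qed simp

text \<open>A complex characteristic polynomial splits into monic linear factors and is thus
  determined by its roots. As a polynomial identity, the spectral condition becomes accessible to
  similarity and continuity arguments.\<close>

lemma spectrum_mset_iff_char_poly:
  assumes "A \<in> carrier_mat n n"
  shows "spectrum_mset A = mset xs \<longleftrightarrow> char_poly (complex_mat A) = (\<Prod>x\<leftarrow>xs. [:- x, 1:])"
proof
  assume *: "spectrum_mset A = mset xs"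
  obtain as where as: "char_poly (complex_mat A) = (\<Prod>a\<leftarrow>as. [:- a, 1:])"
    using char_poly_factorized[of "complex_mat A" n] assms by auto
  then have "mset as = mset xs"
    using * by (simp add: spectrum_mset_def proots_prod_linear)
  then have "(\<Prod>a\<leftarrow>as. [:- a, 1:]) = (\<Prod>x\<leftarrow>xs. [:- x, 1:])"
    by (metis mset_map prod_mset_prod_list)
  then show "char_poly (complex_mat A) = (\<Prod>x\<leftarrow>xs. [:- x, 1:])" using as by simp
qed (simp add: spectrum_mset_def proots_prod_linear)

lemma spectrum_mset_equal_sums:
  assumes "equal_sums_mat n M r" "0 < n"
  shows "spectrum_mset M = add_mset (complex_of_real r)
    (proots (char_poly (complex_mat (helmert_compression n M))))"
proof -
  interpret map_hom: map_poly_comm_ring_hom complex_of_real ..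
  have M: "M \<in> carrier_mat n n" and C: "helmert_compression n M \<in> carrier_mat (n - 1) (n - 1)"
    using assms by (auto simp: equal_sums_mat_def helmert_compression_def)
  have "char_poly (complex_mat M) = map_poly complex_of_real (char_poly M)"
    using of_real_hom.char_poly_hom[OF M] .
  also have "\<dots> = [:- complex_of_real r, 1:]
      * map_poly complex_of_real (char_poly (helmert_compression n M))"
    by (simp add: char_poly_equal_sums[OF assms] map_hom.hom_mult del: mult_pCons_left)
  also have "map_poly complex_of_real (char_poly (helmert_compression n M))
      = char_poly (complex_mat (helmert_compression n M))"
    by (rule of_real_hom.char_poly_hom[OF C, symmetric])
  finally have eq: "char_poly (complex_mat M) = [:- complex_of_real r, 1:]
      * char_poly (complex_mat (helmert_compression n M))" .
  have "char_poly (complex_mat (helmert_compression n M)) \<noteq> 0"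
    using degree_monic_char_poly[of "complex_mat (helmert_compression n M)" "n - 1"] C by auto
  then show ?thesis
    unfolding spectrum_mset_def eq by (subst proots_mult) auto
qed

lemma equal_sums_mat_add_const:
  assumes "equal_sums_mat n M r" "0 < n"
  shows "equal_sums_mat n (M + mat n n (\<lambda>_. t / real n)) (r + t)"
  using assms by (auto simp: equal_sums_mat_def sum.distrib)

text \<open>Only the line sum moves: the remaining eigenvalues are those of the compression, which
  ignores constant matrices.\<close>

lemma spectrum_mset_add_const:
  assumes "equal_sums_mat n M r" "0 < n" "spectrum_mset M = mset (complex_of_real r # ls)"
  shows "spectrum_mset (M + mat n n (\<lambda>_. t / real n)) = mset (complex_of_real (r + t) # ls)"
proof -
  have "M \<in> carrier_mat n n" using assms by (simp add: equal_sums_mat_def)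
  then show ?thesis
    using assms spectrum_mset_equal_sums[OF assms(1,2)]
      spectrum_mset_equal_sums[OF equal_sums_mat_add_const[OF assms(1,2)]]
    by (simp add: helmert_compression_add_const)
qed

section \<open>The Perron eigenvalue as the common line sum\<close>

lemma perron_eigenvalue_unique:
  "perron_eigenvalue A r \<Longrightarrow> perron_eigenvalue A s \<Longrightarrow> r = s"
  unfolding perron_eigenvalue_def by (metis abs_of_nonneg norm_of_real order_antisym)

text \<open>The all-ones vector is an eigenvector for \<open>r\<close>. Reading an eigenvector
  equation at a coordinate of maximal modulus bounds the modulus of its eigenvalue by a row
  sum.\<close>

lemma perron_eigenvalue_equal_sums:
  assumes "equal_sums_mat n A r" "nonnegative_mat A" "0 < n"
  shows "perron_eigenvalue A r"
proof -
  have A: "A \<in> carrier_mat n n"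
    and row: "\<And>i. i < n \<Longrightarrow> (\<Sum>j<n. A $$ (i, j)) = r"
    and nn: "\<And>i j. i < n \<Longrightarrow> j < n \<Longrightarrow> 0 \<le> A $$ (i, j)"
    using assms by (auto simp: equal_sums_mat_def nonnegative_mat_def)
  have r: "0 \<le> r" using row[of 0] nn assms(3) by (metis lessThan_iff sum_nonneg)
  have mult: "(complex_mat A *\<^sub>v v) $ i = (\<Sum>j<n. complex_of_real (A $$ (i, j)) * v $ j)"
    if "v \<in> carrier_vec n" "i < n" for v i
    using A that by (auto simp: scalar_prod_def simp flip: lessThan_atLeast0 intro!: sum.cong)
  have "eigenvector (complex_mat A) (vec n (\<lambda>_. 1)) (complex_of_real r)"
    unfolding eigenvector_def
  proof (intro conjI eq_vecI)
    show "(vec n (\<lambda>_. 1) :: complex vec) \<noteq> 0\<^sub>v (dim_row (complex_mat A))"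
    proof
      assume "(vec n (\<lambda>_. 1) :: complex vec) = 0\<^sub>v (dim_row (complex_mat A))"
      from arg_cong[OF this, of "\<lambda>v. vec_index v 0"] show False using assms(3) A by auto
    qed
    fix i assume "i < dim_vec (complex_of_real r \<cdot>\<^sub>v vec n (\<lambda>_. 1))"
    then show "(complex_mat A *\<^sub>v vec n (\<lambda>_. 1)) $ i = (complex_of_real r \<cdot>\<^sub>v vec n (\<lambda>_. 1)) $ i"
      using row[of i] by (simp add: mult flip: of_real_sum)
  qed (use A in auto)
  moreover have "cmod \<mu> \<le> r" if ev: "eigenvalue (complex_mat A) \<mu>" for \<mu>
  proof -
    obtain v where v: "v \<in> carrier_vec n" "v \<noteq> 0\<^sub>v n" "complex_mat A *\<^sub>v v = \<mu> \<cdot>\<^sub>v v"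
      using ev A by (auto simp: eigenvalue_def eigenvector_def)
    define s where "s = Max ((\<lambda>i. cmod (v $ i)) ` {..<n})"
    have le: "cmod (v $ i) \<le> s" if "i < n" for i
      unfolding s_def using that by (intro Max_ge) auto
    have "s \<in> (\<lambda>i. cmod (v $ i)) ` {..<n}"
      unfolding s_def using assms(3) by (intro Max_in) auto
    then obtain i where i: "i < n" "cmod (v $ i) = s" by auto
    have s: "s > 0"
    proof (rule ccontr)
      assume "\<not> s > 0"
      then have "cmod (v $ j) \<le> 0" if "j < n" for j using le[OF that] by linarith
      then have "v = 0\<^sub>v n" using v(1) by (intro eq_vecI) (auto simp: norm_le_zero_iff)
      with v(2) show False by simp
    qed
    have "cmod \<mu> * s = cmod ((\<mu> \<cdot>\<^sub>v v) $ i)" using i v(1) by (simp add: norm_mult)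
    also have "\<dots> = cmod (\<Sum>j<n. complex_of_real (A $$ (i, j)) * v $ j)"
      using mult[OF v(1) i(1)] v(3) by simp
    also have "\<dots> \<le> (\<Sum>j<n. A $$ (i, j) * s)"
      by (intro sum_norm_le) (use nn i le in \<open>auto simp: norm_mult intro!: mult_left_mono\<close>)
    also have "\<dots> = r * s" using row[OF i(1)] by (simp flip: sum_distrib_right)
    finally show ?thesis using s by simp
  qed
  ultimately show ?thesis using r by (auto simp: perron_eigenvalue_def eigenvalue_def)
qed

text \<open>The common sum is a Perron eigenvalue, and by uniqueness it can only be
  \<open>l1\<close>; this removes the Perron condition and the unnamed sum from the problem.\<close>

lemma gen_doubly_stochastic_realizes_iff:
  assumes "A \<in> carrier_mat n n" "0 < n"
  shows "gen_doubly_stochastic A \<and> realizes A l1 ls \<longleftrightarrow>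
    nonnegative_mat A \<and> equal_sums_mat n A l1 \<and> spectrum_mset A = mset (complex_of_real l1 # ls)"
    (is "?L \<longleftrightarrow> ?R")
proof
  assume L: ?L
  then obtain r where r: "equal_sums_mat n A r"
    using assms by (auto simp: gen_doubly_stochastic_def equal_sums_mat_def)
  then have "perron_eigenvalue A r"
    using perron_eigenvalue_equal_sums L assms(2) by (auto simp: realizes_def)
  then have "r = l1" using L perron_eigenvalue_unique by (auto simp: realizes_def)
  then show ?R using L r by (auto simp: realizes_def)
next
  assume R: ?R
  then have "perron_eigenvalue A l1" using perron_eigenvalue_equal_sums assms(2) by auto
  then show ?L using R assms
    by (auto simp: realizes_def gen_doubly_stochastic_def equal_sums_mat_def perron_eigenvalue_def)
qed

section \<open>Real normal matrices with prescribed spectrum\<close>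

text \<open>With \<open>U\<close> having columns \<open>z k\<close>, \<open>V\<close> its adjoint
  and \<open>D\<close> the diagonal matrix of the \<open>\<mu> k\<close>, the hypotheses say that
  \<open>U * V\<close> is the identity and that \<open>U * D * V\<close> is the given real matrix,
  which is hence similar to \<open>D\<close>.\<close>

lemma spectrum_mset_unitary_diagonalization:
  fixes z :: "nat \<Rightarrow> nat \<Rightarrow> complex" and a :: "nat \<Rightarrow> nat \<Rightarrow> real"
  assumes on: "\<And>i j. i < n \<Longrightarrow> j < n \<Longrightarrow> (\<Sum>k<n. z k i * cnj (z k j)) = (if i = j then 1 else 0)"
    and a: "\<And>i j. i < n \<Longrightarrow> j < n \<Longrightarrow> (\<Sum>k<n. \<mu> k * z k i * cnj (z k j)) = complex_of_real (a i j)"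
  shows "spectrum_mset (mat n n (\<lambda>(i, j). a i j)) = mset (map \<mu> [0..<n])"
proof -
  define U where "U = mat n n (\<lambda>(i, k). z k i)"
  define V where "V = mat n n (\<lambda>(k, j). cnj (z k j))"
  define D where "D = mat n n (\<lambda>(k, l). if k = l then \<mu> k else 0)"
  let ?A = "complex_mat (mat n n (\<lambda>(i, j). a i j))"
  have UV: "U * V = 1\<^sub>m n"
    by (rule eq_matI) (auto simp: U_def V_def scalar_prod_def on simp flip: lessThan_atLeast0)
  have VU: "V * U = 1\<^sub>m n"
    by (rule mat_mult_left_right_inverse[OF _ _ UV]) (auto simp: U_def V_def)
  have UD: "U * D = mat n n (\<lambda>(i, k). z k i * \<mu> k)"
  proof (rule eq_matI)
    fix i k assume "i < dim_row (mat n n (\<lambda>(i, k). z k i * \<mu> k))" "k < dim_col (mat n n (\<lambda>(i, k). z k i * \<mu> k))"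
    then have ik: "i < n" "k < n" by auto
    have "(U * D) $$ (i, k) = (\<Sum>l<n. z l i * (if l = k then \<mu> l else 0))"
      using ik by (simp add: U_def D_def scalar_prod_def flip: lessThan_atLeast0)
    also have "\<dots> = (\<Sum>l<n. if l = k then z l i * \<mu> l else 0)"
      by (intro sum.cong) auto
    finally have "(U * D) $$ (i, k) = (\<Sum>l<n. if l = k then z l i * \<mu> l else 0)" .
    then show "(U * D) $$ (i, k) = mat n n (\<lambda>(i, k). z k i * \<mu> k) $$ (i, k)"
      using ik by simp
  qed (auto simp: U_def D_def)
  have "?A = U * D * V"
    unfolding UD
    by (rule eq_matI)
      (auto simp: V_def scalar_prod_def mult_ac simp flip: lessThan_atLeast0 a)
  then have "similar_mat ?A D"
    by (intro similar_matI[of _ _ U V n] UV VU) (auto simp: U_def V_def D_def)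
  then have "char_poly ?A = char_poly D" by (rule char_poly_similar)
  also have "\<dots> = (\<Prod>x\<leftarrow>diag_mat D. [:- x, 1:])"
    by (rule char_poly_upper_triangular[of _ n]) (auto simp: D_def)
  also have "diag_mat D = map \<mu> [0..<n]"
    by (auto simp: diag_mat_def D_def)
  finally show ?thesis by (subst spectrum_mset_iff_char_poly[of _ n]) auto
qed

lemma sum_lessThan_add_double:
  fixes f :: "nat \<Rightarrow> 'a::comm_monoid_add"
  shows "(\<Sum>k<p + 2 * m. f k) = (\<Sum>k<p. f k) + (\<Sum>r<m. f (p + 2 * r) + f (p + 2 * r + 1))"
  by (induction m) (auto simp: ac_simps)

lemma mset_map_upt_add_double:
  "mset (map f [0..<p + 2 * m]) = mset (map f [0..<p])
    + mset (map (\<lambda>r. f (p + 2 * r)) [0..<m]) + mset (map (\<lambda>r. f (p + 2 * r + 1)) [0..<m])"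
  by (induction m) auto

text \<open>For orthonormal \<open>q\<close>, this is the matrix acting as \<open>L k\<close> on
  \<open>q k\<close> for \<open>k < p\<close>, and on the r-th pair of consecutive later vectors as
  multiplication by \<open>Z r\<close>, that is, by the block with rows (x, -y) and (y, x).\<close>

definition normal_entry ::
    "(nat \<Rightarrow> nat \<Rightarrow> real) \<Rightarrow> nat \<Rightarrow> nat \<Rightarrow> (nat \<Rightarrow> real) \<Rightarrow> (nat \<Rightarrow> complex) \<Rightarrow> nat \<Rightarrow> nat \<Rightarrow> real" where
  "normal_entry q p m L Z i j =
    (\<Sum>k<p. L k * (q k i * q k j)) +
    (\<Sum>r<m. Re (Z r) * (q (p + 2 * r) i * q (p + 2 * r) j + q (p + 2 * r + 1) i * q (p + 2 * r + 1) j)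
          - Im (Z r) * (q (p + 2 * r) i * q (p + 2 * r + 1) j - q (p + 2 * r + 1) i * q (p + 2 * r) j))"

text \<open>Transposing a rotation-scaling block conjugates its complex number, so column sums
  become row sums of a matrix of the same form.\<close>

lemma normal_entry_swap:
  "normal_entry q p m L Z j i = normal_entry q p m L (\<lambda>r. cnj (Z r)) i j"
  unfolding normal_entry_def by (intro arg_cong2[of _ _ _ _ "(+)"] sum.cong) (auto simp: algebra_simps)

definition pair_eigenvalue :: "nat \<Rightarrow> (nat \<Rightarrow> real) \<Rightarrow> (nat \<Rightarrow> complex) \<Rightarrow> nat \<Rightarrow> complex" where
  "pair_eigenvalue p L Z k =
    (if k < p then complex_of_real (L k)
     else if even (k - p) then Z ((k - p) div 2) else cnj (Z ((k - p) div 2)))"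

text \<open>A block on u, v has the unit eigenvectors (u - i v) / sqrt 2 and its conjugate. An even
  offset from \<open>p\<close> finds its partner at \<open>k + 1\<close>, an odd one at
  \<open>k - 1\<close>.\<close>

definition pair_eigenvector :: "(nat \<Rightarrow> nat \<Rightarrow> real) \<Rightarrow> nat \<Rightarrow> nat \<Rightarrow> nat \<Rightarrow> complex" where
  "pair_eigenvector q p k i =
    (if k < p then complex_of_real (q k i)
     else if even (k - p) then Complex (q k i) (- q (k + 1) i) / complex_of_real (sqrt 2)
     else Complex (q (k - 1) i) (q k i) / complex_of_real (sqrt 2))"

text \<open>The two summands are complex conjugates, so their sum is twice a real part; the two
  factors \<open>1 / sqrt 2\<close> cancel the 2.\<close>

lemma conjugate_pair_rank_two:
  "z * (Complex a (- b) / complex_of_real (sqrt 2)) * cnj (Complex c (- d) / complex_of_real (sqrt 2))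
    + cnj z * (Complex a b / complex_of_real (sqrt 2)) * cnj (Complex c d / complex_of_real (sqrt 2))
   = complex_of_real (Re z * (a * c + b * d) - Im z * (a * d - b * c))"
proof -
  have s: "complex_of_real (sqrt 2) * complex_of_real (sqrt 2) = 2"
    by (simp flip: of_real_mult)
  have normalize: "x * (u / complex_of_real (sqrt 2)) * cnj (v / complex_of_real (sqrt 2)) = x * u * cnj v / 2"
    for x u v
    by (simp add: s)
  have "z * Complex a (- b) * cnj (Complex c (- d)) + cnj z * Complex a b * cnj (Complex c d)
      = 2 * complex_of_real (Re z * (a * c + b * d) - Im z * (a * d - b * c))"
    by (simp add: complex_eq_iff algebra_simps)
  then show ?thesis
    unfolding normalize add_divide_distrib[symmetric] by (simp only:) simp
qed

lemma sum_pair_eigenvector: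
  "(\<Sum>k<p + 2 * m. pair_eigenvalue p L Z k * pair_eigenvector q p k i * cnj (pair_eigenvector q p k j))
    = complex_of_real (normal_entry q p m L Z i j)"
proof -
  have "pair_eigenvalue p L Z (p + 2 * r) * pair_eigenvector q p (p + 2 * r) i * cnj (pair_eigenvector q p (p + 2 * r) j)
      + pair_eigenvalue p L Z (p + 2 * r + 1) * pair_eigenvector q p (p + 2 * r + 1) i * cnj (pair_eigenvector q p (p + 2 * r + 1) j)
    = complex_of_real (Re (Z r) * (q (p + 2 * r) i * q (p + 2 * r) j + q (p + 2 * r + 1) i * q (p + 2 * r + 1) j)
          - Im (Z r) * (q (p + 2 * r) i * q (p + 2 * r + 1) j - q (p + 2 * r + 1) i * q (p + 2 * r) j))" for r
    using conjugate_pair_rank_two[of "Z r" "q (p + 2 * r) i" "q (p + 2 * r + 1) i" "q (p + 2 * r) j" "q (p + 2 * r + 1) j"]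
    by (simp add: pair_eigenvalue_def pair_eigenvector_def)
  then show ?thesis
    unfolding sum_lessThan_add_double normal_entry_def of_real_add of_real_sum
    by (intro arg_cong2[of _ _ _ _ "(+)"] sum.cong)
      (auto simp: pair_eigenvalue_def pair_eigenvector_def)
qed

lemma spectrum_mset_normal_entry:
  fixes p m :: nat
  defines "n \<equiv> p + 2 * m"
  assumes "\<And>i j. i < n \<Longrightarrow> j < n \<Longrightarrow> (\<Sum>k<n. q k i * q k j) = (if i = j then 1 else 0)"
  shows "spectrum_mset (mat n n (\<lambda>(i, j). normal_entry q p m L Z i j))
    = mset (map (\<lambda>k. complex_of_real (L k)) [0..<p]) + mset (map Z [0..<m]) + mset (map (\<lambda>r. cnj (Z r)) [0..<m])"
proof -
  \<comment> \<open>With all eigenvalues equal to 1 the entry is the completeness sum of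
    \<open>q\<close>; \<open>sum_pair_eigenvector\<close> thus also yields the unitarity of the
    complex eigenvectors.\<close>
  have 1: "normal_entry q p m (\<lambda>_. 1) (\<lambda>_. 1) i j = (\<Sum>k<n. q k i * q k j)" for i j
    unfolding n_def sum_lessThan_add_double normal_entry_def by simp
  have one: "pair_eigenvalue p (\<lambda>_. 1) (\<lambda>_. 1) k = 1" for k
    by (simp add: pair_eigenvalue_def)
  have "spectrum_mset (mat n n (\<lambda>(i, j). normal_entry q p m L Z i j)) = mset (map (pair_eigenvalue p L Z) [0..<n])"
  proof (rule spectrum_mset_unitary_diagonalization[where z = "pair_eigenvector q p"])
    fix i j assume ij: "i < n" "j < n"
    show "(\<Sum>k<n. pair_eigenvector q p k i * cnj (pair_eigenvector q p k j)) = (if i = j then 1 else 0)"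
      using sum_pair_eigenvector[of p "\<lambda>_. 1" "\<lambda>_. 1" q i j m] assms(2)[OF ij]
      by (simp add: one 1 flip: n_def)
  qed (simp add: n_def sum_pair_eigenvector)
  also have "\<dots> = mset (map (\<lambda>k. complex_of_real (L k)) [0..<p]) + mset (map Z [0..<m]) + mset (map (\<lambda>r. cnj (Z r)) [0..<m])"
  proof -
    have 1: "map (pair_eigenvalue p L Z) [0..<p] = map (\<lambda>k. complex_of_real (L k)) [0..<p]"
      by (auto simp: pair_eigenvalue_def)
    have 2: "pair_eigenvalue p L Z (p + 2 * r) = Z r" "pair_eigenvalue p L Z (p + 2 * r + 1) = cnj (Z r)" for r
      by (auto simp: pair_eigenvalue_def)
    show ?thesis
      by (simp only: n_def mset_map_upt_add_double 1 2)
  qed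
  finally show ?thesis .
qed

text \<open>Every vector except \<open>q 0\<close> has coordinate sum zero, so only the term of
  \<open>L 0\<close> survives.\<close>

lemma sum_normal_entry:
  assumes "0 < p" "n = p + 2 * m"
    and "\<And>k. 0 < k \<Longrightarrow> k < n \<Longrightarrow> (\<Sum>j<n. q k j) = 0"
  shows "(\<Sum>j<n. normal_entry q p m L Z i j) = L 0 * q 0 i * (\<Sum>j<n. q 0 j)"
proof -
  let ?s = "\<lambda>k. \<Sum>j<n. q k j"
  have "(\<Sum>j<n. normal_entry q p m L Z i j)
      = (\<Sum>k<p. L k * q k i * ?s k) +
        (\<Sum>r<m. Re (Z r) * (q (p + 2 * r) i * ?s (p + 2 * r) + q (p + 2 * r + 1) i * ?s (p + 2 * r + 1))
          - Im (Z r) * (q (p + 2 * r) i * ?s (p + 2 * r + 1) - q (p + 2 * r + 1) i * ?s (p + 2 * r)))"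
    unfolding normal_entry_def sum.distrib
    by (subst (1 2) sum.swap)
      (simp add: sum_subtractf sum.distrib sum_distrib_left algebra_simps)
  also have "(\<Sum>r<m. Re (Z r) * (q (p + 2 * r) i * ?s (p + 2 * r) + q (p + 2 * r + 1) i * ?s (p + 2 * r + 1))
          - Im (Z r) * (q (p + 2 * r) i * ?s (p + 2 * r + 1) - q (p + 2 * r + 1) i * ?s (p + 2 * r))) = 0"
    by (rule sum.neutral) (use assms in auto)
  also have "(\<Sum>k<p. L k * q k i * ?s k) = L 0 * q 0 i * ?s 0 + (\<Sum>k\<in>{..<p} - {0}. L k * q k i * ?s k)"
    using assms(1) by (subst sum.remove[of _ 0]) auto
  also have "(\<Sum>k\<in>{..<p} - {0}. L k * q k i * ?s k) = 0"
    by (rule sum.neutral) (use assms in auto)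
  finally show ?thesis by simp
qed

section \<open>Lower bounds for the entries\<close>

text \<open>AM-GM separates the two coordinates, so that a bound for the entry at (i, j) can be the
  average of one at i and one at j.\<close>

lemma weighted_product_lower_bound:
  assumes "\<bar>c\<bar> \<le> (W::real)"
  shows "- (W * (x\<^sup>2 + y\<^sup>2) / 2) \<le> c * (x * y)"
proof -
  have "2 * (\<bar>x\<bar> * \<bar>y\<bar>) \<le> x\<^sup>2 + y\<^sup>2"
    using sum_squares_bound[of "\<bar>x\<bar>" "\<bar>y\<bar>"] by (simp add: power2_eq_square)
  then have xy: "\<bar>x\<bar> * \<bar>y\<bar> \<le> (x\<^sup>2 + y\<^sup>2) / 2" by simp
  have "- (c * (x * y)) \<le> \<bar>c\<bar> * (\<bar>x\<bar> * \<bar>y\<bar>)" by (metis abs_ge_minus_self abs_mult)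
  also have "\<dots> \<le> W * ((x\<^sup>2 + y\<^sup>2) / 2)"
    by (rule mult_mono) (use assms xy in auto)
  finally show ?thesis by simp
qed

text \<open>Each of the four products has a coefficient of modulus at most \<open>W\<close>, and
  their absolute values sum to (|a| + |b|) (|c| + |d|), to which AM-GM applies.\<close>

lemma rotation_block_lower_bound:
  assumes "\<bar>x\<bar> \<le> (W::real)" "\<bar>y\<bar> \<le> W"
  shows "- (W * ((\<bar>a\<bar> + \<bar>b\<bar>)\<^sup>2 + (\<bar>c\<bar> + \<bar>d\<bar>)\<^sup>2) / 2) \<le> x * (a * c + b * d) - y * (a * d - b * c)"
proof -
  have W: "0 \<le> W" using assms(1) by linarith
  have le: "u * t \<ge> - (W * \<bar>t\<bar>)" if "\<bar>u\<bar> \<le> W" for u t :: real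
  proof -
    have "- (u * t) \<le> \<bar>u\<bar> * \<bar>t\<bar>" by (metis abs_ge_minus_self abs_mult)
    also have "\<dots> \<le> W * \<bar>t\<bar>" using that by (intro mult_right_mono) auto
    finally show ?thesis by simp
  qed
  have "- (W * ((\<bar>a\<bar> + \<bar>b\<bar>)\<^sup>2 + (\<bar>c\<bar> + \<bar>d\<bar>)\<^sup>2) / 2) \<le> (- W) * ((\<bar>a\<bar> + \<bar>b\<bar>) * (\<bar>c\<bar> + \<bar>d\<bar>))"
    by (rule weighted_product_lower_bound) (use W in auto)
  also have "\<dots> = - (W * \<bar>a * c\<bar>) + - (W * \<bar>b * d\<bar>) + - (W * \<bar>a * d\<bar>) + - (W * \<bar>b * c\<bar>)"
    by (simp add: abs_mult algebra_simps)
  also have "\<dots> \<le> x * (a * c) + x * (b * d) + (- y) * (a * d) + y * (b * c)"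
    by (intro add_mono le) (use assms in auto)
  also have "\<dots> = x * (a * c + b * d) - y * (a * d - b * c)" by (simp add: algebra_simps)
  finally show ?thesis .
qed

text \<open>The constant direction is kept exactly; all other terms are estimated one by one, and
  the resulting averages over \<open>i\<close> and \<open>j\<close> are bounded by
  \<open>B\<close>.\<close>

lemma normal_entry_lower_bound:
  assumes p: "0 < p"
    and L: "\<And>k. 0 < k \<Longrightarrow> k < p \<Longrightarrow> \<bar>L k\<bar> \<le> W"
    and Z: "\<And>r. r < m \<Longrightarrow> \<bar>Re (Z r)\<bar> \<le> W \<and> \<bar>Im (Z r)\<bar> \<le> W"
    and W: "0 \<le> W"
    and F: "\<And>i. i < n \<Longrightarrow> (\<Sum>k\<in>{1..<p}. (q k i)\<^sup>2) + (\<Sum>r<m. (\<bar>q (p + 2 * r) i\<bar> + \<bar>q (p + 2 * r + 1) i\<bar>)\<^sup>2) \<le> B"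
    and ij: "i < n" "j < n"
  shows "L 0 * (q 0 i * q 0 j) - W * B \<le> normal_entry q p m L Z i j"
proof -
  let ?f = "\<lambda>i k. (q k i)\<^sup>2"
  let ?g = "\<lambda>i r. (\<bar>q (p + 2 * r) i\<bar> + \<bar>q (p + 2 * r + 1) i\<bar>)\<^sup>2"
  let ?F = "\<lambda>i. (\<Sum>k\<in>{1..<p}. ?f i k) + (\<Sum>r<m. ?g i r)"
  have average: "(x + y) / 2 \<le> B" if "x \<le> B" "y \<le> B" for x y
    using that by simp
  have "(?F i + ?F j) / 2 \<le> B"
    by (rule average[OF F[OF ij(1)] F[OF ij(2)]])
  then have "- (W * B) \<le> - (W * ((?F i + ?F j) / 2))"
    by (intro le_imp_neg_le mult_left_mono W)
  also have "- (W * ((?F i + ?F j) / 2))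
      = (\<Sum>k\<in>{1..<p}. - (W * (?f i k + ?f j k) / 2)) + (\<Sum>r<m. - (W * (?g i r + ?g j r) / 2))"
    by (simp only: sum_negf sum_divide_distrib[symmetric] sum_distrib_left[symmetric] sum.distrib)
      (simp add: field_simps)
  also have "\<dots> \<le> (\<Sum>k\<in>{1..<p}. L k * (q k i * q k j)) +
    (\<Sum>r<m. Re (Z r) * (q (p + 2 * r) i * q (p + 2 * r) j + q (p + 2 * r + 1) i * q (p + 2 * r + 1) j)
          - Im (Z r) * (q (p + 2 * r) i * q (p + 2 * r + 1) j - q (p + 2 * r + 1) i * q (p + 2 * r) j))"
    by (intro add_mono sum_mono weighted_product_lower_bound rotation_block_lower_bound)
      (use L Z in auto)
  also have "\<dots> = normal_entry q p m L Z i j - L 0 * (q 0 i * q 0 j)"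
  proof -
    have "{..<p} = insert 0 {1..<p}" using p by auto
    then have "(\<Sum>k<p. L k * (q k i * q k j)) = L 0 * (q 0 i * q 0 j) + (\<Sum>k\<in>{1..<p}. L k * (q k i * q k j))"
      by simp
    then show ?thesis unfolding normal_entry_def by linarith
  qed
  finally show ?thesis by linarith
qed

lemma parity_helmert_square_sum_bound:
  assumes p: "0 < p" and n: "n = p + 2 * m" and small: "2 \<le> p \<or> n = 3" and i: "i < n"
  shows "(\<Sum>k\<in>{1..<p}. (parity_helmert n k i)\<^sup>2)
    + (\<Sum>r<m. (\<bar>parity_helmert n (p + 2 * r) i\<bar> + \<bar>parity_helmert n (p + 2 * r + 1) i\<bar>)\<^sup>2) \<le> 1 + 1 / real n"
    (is "?R + ?P \<le> _")
proof -
  let ?q = "parity_helmert n"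
  let ?Q = "\<Sum>r<m. (?q (p + 2 * r) i)\<^sup>2 + (?q (p + 2 * r + 1) i)\<^sup>2"
  \<comment> \<open>Completeness at (i, i): all squares sum to 1, and the constant vector
    contributes \<open>1 / n\<close>.\<close>
  have "1 = (\<Sum>k<p + 2 * m. (?q k i)\<^sup>2)"
    using parity_helmert_orthonormal_cols[OF i i] by (simp add: n power2_eq_square)
  also have "\<dots> = (\<Sum>k<p. (?q k i)\<^sup>2) + ?Q"
    by (rule sum_lessThan_add_double)
  also have "{..<p} = insert 0 {1..<p}" using p by auto
  also have "(\<Sum>k\<in>insert 0 {1..<p}. (?q k i)\<^sup>2) = 1 / n + ?R"
    by (simp add: parity_helmert_0 power_divide)
  finally have total: "?R + ?Q = 1 - 1 / n" by simp
  have R: "0 \<le> ?R" by (intro sum_nonneg) auto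
  show ?thesis
  proof (cases "2 \<le> p")
    case True
    have "?P = ?Q"
    proof (rule sum.cong)
      fix r assume "r \<in> {..<m}"
      \<comment> \<open>Both indices are at least 2 and of opposite parity, so the supports are
        disjoint and the cross term vanishes.\<close>
      have "?q (p + 2 * r) i = 0 \<or> ?q (p + 2 * r + 1) i = 0"
      proof (rule ccontr)
        assume nz: "\<not> ?thesis"
        have "2 \<le> p + 2 * r" "2 \<le> p + 2 * r + 1" using True by auto
        then have "i mod 2 = (p + 2 * r) mod 2" "i mod 2 = (p + 2 * r + 1) mod 2"
          using nz parity_helmert_support by blast+
        then show False by presburger
      qed
      then show "(\<bar>?q (p + 2 * r) i\<bar> + \<bar>?q (p + 2 * r + 1) i\<bar>)\<^sup>2
          = (?q (p + 2 * r) i)\<^sup>2 + (?q (p + 2 * r + 1) i)\<^sup>2" by auto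
    qed simp
    moreover have "1 - 1 / real n \<le> 1 + 1 / real n" by simp
    ultimately show ?thesis using total by linarith
  next
    case False
    with assms(3) have n3: "n = 3" by simp
    \<comment> \<open>Now \<open>p = 1\<close>, and the pair consists of the overlapping vectors 1
      and 2. Absorbing the cross term costs a factor 2, which \<open>n = 3\<close> just
      allows.\<close>
    have "?P \<le> (\<Sum>r<m. 2 * ((?q (p + 2 * r) i)\<^sup>2 + (?q (p + 2 * r + 1) i)\<^sup>2))"
    proof (rule sum_mono)
      fix r
      show "(\<bar>?q (p + 2 * r) i\<bar> + \<bar>?q (p + 2 * r + 1) i\<bar>)\<^sup>2
          \<le> 2 * ((?q (p + 2 * r) i)\<^sup>2 + (?q (p + 2 * r + 1) i)\<^sup>2)"
        using sum_squares_bound[of "\<bar>?q (p + 2 * r) i\<bar>" "\<bar>?q (p + 2 * r + 1) i\<bar>"]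
        by (simp add: power2_sum)
    qed
    also have "\<dots> = 2 * ?Q" by (simp only: sum_distrib_left)
    finally have P: "?P \<le> 2 * ?Q" .
    have "x + y \<le> 2 * (x + z)" if "y \<le> 2 * z" "0 \<le> x" for x y z :: real
      using that by simp
    from this[OF P R] have "?R + ?P \<le> 2 * (?R + ?Q)" .
    also have "\<dots> = 1 + 1 / real n" by (subst total) (simp add: n3)
    finally show ?thesis .
  qed
qed

text \<open>The constant direction adds \<open>L 0 / n = W * (1 + 1 / n)\<close> to every entry,
  exactly the amount by which the other terms can be negative.\<close>

lemma exists_realization:
  assumes p: "0 < p" and n: "n = p + 2 * m" and small: "2 \<le> p \<or> n = 3" and W: "0 \<le> W"
    and L: "\<And>k. 0 < k \<Longrightarrow> k < p \<Longrightarrow> \<bar>L k\<bar> \<le> W"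
    and Z: "\<And>r. r < m \<Longrightarrow> \<bar>Re (Z r)\<bar> \<le> W \<and> \<bar>Im (Z r)\<bar> \<le> W"
    and L0: "L 0 = (real n + 1) * W"
  shows "\<exists>A. nonnegative_mat A \<and> equal_sums_mat n A (L 0) \<and>
    spectrum_mset A = mset (map (\<lambda>k. complex_of_real (L k)) [0..<p]) + mset (map Z [0..<m])
      + mset (map (\<lambda>r. cnj (Z r)) [0..<m])"
proof -
  let ?q = "parity_helmert n"
  let ?A = "mat n n (\<lambda>(i, j). normal_entry ?q p m L Z i j)"
  have n0: "0 < n" using p n by simp
  have "nonnegative_mat ?A"
    unfolding nonnegative_mat_def
  proof (intro allI impI)
    fix i j assume "i < dim_row ?A" "j < dim_col ?A"
    then have ij: "i < n" "j < n" by auto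
    have "L 0 * (?q 0 i * ?q 0 j) - W * (1 + 1 / real n) \<le> normal_entry ?q p m L Z i j"
      using normal_entry_lower_bound[OF p L Z W parity_helmert_square_sum_bound[OF p n assms(3)] ij] .
    moreover have "L 0 * (?q 0 i * ?q 0 j) = W * (1 + 1 / real n)"
      using n0 by (simp add: parity_helmert_0 L0 field_simps)
    ultimately show "0 \<le> ?A $$ (i, j)" using ij by simp
  qed
  moreover have "equal_sums_mat n ?A (L 0)"
  proof -
    have "(\<Sum>j<n. normal_entry ?q p m L Z' i j) = L 0" for Z' i
      using n0 by (subst sum_normal_entry[OF p n sum_parity_helmert])
        (auto simp: parity_helmert_0)
    moreover have "(\<Sum>i<n. normal_entry ?q p m L Z i j) = (\<Sum>i<n. normal_entry ?q p m L (\<lambda>r. cnj (Z r)) j i)" for j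
      by (simp add: normal_entry_swap[of _ _ _ _ _ _ j])
    ultimately show ?thesis by (auto simp: equal_sums_mat_def)
  qed
  moreover note spectrum_mset_normal_entry[of p m ?q L Z, folded n, OF parity_helmert_orthonormal_cols]
  ultimately show ?thesis by blast
qed

section \<open>Compactness and the least realizable line sum\<close>

text \<open>The Leibniz formula shows each value of the characteristic polynomial as a polynomial in
  the entries, hence continuous in them.\<close>

lemma poly_char_poly_Leibniz:
  fixes A :: "complex mat"
  assumes "A \<in> carrier_mat n n"
  shows "poly (char_poly A) x = (\<Sum>\<pi>\<in>{\<pi>. \<pi> permutes {0..<n}}. signof \<pi> *
    (\<Prod>i = 0..<n. (if i = \<pi> i then x else 0) - A $$ (i, \<pi> i)))"
proof -
  have "poly (char_poly A) x = (\<Sum>\<pi>\<in>{\<pi>. \<pi> permutes {0..<n}}. poly (signof \<pi>) x *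
    (\<Prod>i = 0..<n. poly (char_poly_matrix A $$ (i, \<pi> i)) x))"
    using assms by (simp add: char_poly_def det_def'[of _ n] poly_sum poly_prod)
  also have "\<dots> = (\<Sum>\<pi>\<in>{\<pi>. \<pi> permutes {0..<n}}. signof \<pi> *
    (\<Prod>i = 0..<n. (if i = \<pi> i then x else 0) - A $$ (i, \<pi> i)))"
  proof (intro sum.cong arg_cong2[of _ _ _ _ "(*)"] prod.cong refl)
    fix \<pi> i assume "\<pi> \<in> {\<pi>. \<pi> permutes {0..<n}}" "i \<in> {0..<n}"
    then have "i < n" "\<pi> i < n" using permutes_in_image[of \<pi> "{0..<n}" i] by auto
    then show "poly (char_poly_matrix A $$ (i, \<pi> i)) x = (if i = \<pi> i then x else 0) - A $$ (i, \<pi> i)"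
      using assms by (auto simp: char_poly_matrix_def)
  qed (auto simp: sign_def)
  finally show ?thesis .
qed

lemma continuous_on_coordinate: "continuous_on S (\<lambda>f :: 'a \<Rightarrow> real. f k)"
  by (rule continuous_on_subset[OF continuous_on_product_coordinates]) simp

lemma continuous_on_poly_char_poly:
  "continuous_on S (\<lambda>f. poly (char_poly (complex_mat (mat n n f))) x)"
proof -
  have "poly (char_poly (complex_mat (mat n n f))) x = (\<Sum>\<pi>\<in>{\<pi>. \<pi> permutes {0..<n}}. signof \<pi> *
    (\<Prod>i = 0..<n. (if i = \<pi> i then x else 0) - complex_of_real (f (i, \<pi> i))))" for f
  proof (subst poly_char_poly_Leibniz[of _ n])
    show "(\<Sum>\<pi>\<in>{\<pi>. \<pi> permutes {0..<n}}. signof \<pi> *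
      (\<Prod>i = 0..<n. (if i = \<pi> i then x else 0) - complex_mat (mat n n f) $$ (i, \<pi> i)))
      = (\<Sum>\<pi>\<in>{\<pi>. \<pi> permutes {0..<n}}. signof \<pi> *
      (\<Prod>i = 0..<n. (if i = \<pi> i then x else 0) - complex_of_real (f (i, \<pi> i))))"
    proof (intro sum.cong arg_cong2[of _ _ _ _ "(*)"] prod.cong refl)
      fix \<pi> i assume "\<pi> \<in> {\<pi>. \<pi> permutes {0..<n}}" "i \<in> {0..<n}"
      then have "i < n" "\<pi> i < n" using permutes_in_image[of \<pi> "{0..<n}" i] by auto
      then show "(if i = \<pi> i then x else 0) - complex_mat (mat n n f) $$ (i, \<pi> i)
        = (if i = \<pi> i then x else 0) - complex_of_real (f (i, \<pi> i))" by simp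
    qed
  qed simp
  then show ?thesis
    by (simp only:) (intro continuous_intros continuous_on_coordinate)
qed

text \<open>Tychonoff's theorem; matrices are encoded as functions on index pairs with the product
  topology.\<close>

lemma compact_function_box: "compact (PiE UNIV (\<lambda>_. {0..M}) :: ('a \<Rightarrow> real) set)"
proof -
  have "compactin (product_topology (\<lambda>_. euclidean) UNIV) (PiE UNIV (\<lambda>_. {0..M}) :: ('a \<Rightarrow> real) set)"
    by (subst compactin_PiE) (auto simp: compactin_euclidean_iff)
  then show ?thesis by (simp add: euclidean_product_topology compactin_euclidean_iff)
qed

definition realizable_equal_sums :: "nat \<Rightarrow> complex list \<Rightarrow> real \<Rightarrow> bool" where
  "realizable_equal_sums n ls l \<longleftrightarrow>
    (\<exists>A. nonnegative_mat A \<and> equal_sums_mat n A l \<and> spectrum_mset A = mset (complex_of_real l # ls))"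

text \<open>The constant \<open>(l' - l) / n\<close> is nonnegative, so adding it everywhere keeps
  the matrix nonnegative and changes only the line sum.\<close>

lemma realizable_equal_sums_add:
  assumes "realizable_equal_sums n ls l" "0 < n" "l \<le> l'"
  shows "realizable_equal_sums n ls l'"
proof -
  obtain A where A: "nonnegative_mat A" "equal_sums_mat n A l" "spectrum_mset A = mset (complex_of_real l # ls)"
    using assms by (auto simp: realizable_equal_sums_def)
  let ?B = "A + mat n n (\<lambda>_. (l' - l) / real n)"
  have "nonnegative_mat ?B"
    using A(1,2) assms by (auto simp: nonnegative_mat_def equal_sums_mat_def)
  then show ?thesis
    using equal_sums_mat_add_const[OF A(2) assms(2), of "l' - l"]
      spectrum_mset_add_const[OF A(2) assms(2) A(3), of "l' - l"]
    unfolding realizable_equal_sums_def by auto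
qed

text \<open>Realizations with line sum at most \<open>M\<close> have entries in
  \<open>{0..M}\<close> and satisfy closed conditions. The line sum therefore attains its minimum,
  and upward closure turns the minimum into a threshold.\<close>

lemma realizable_equal_sums_least:
  assumes M: "realizable_equal_sums n ls M" and n: "0 < n"
  obtains l0 where "l0 \<le> M" "\<And>l. realizable_equal_sums n ls l \<longleftrightarrow> l0 \<le> l"
proof -
  define r where "r f = (\<Sum>j<n. f (0::nat, j))" for f :: "nat \<times> nat \<Rightarrow> real"
  let ?c = "\<lambda>f x. poly (char_poly (complex_mat (mat n n f))) x"
  define K :: "(nat \<times> nat \<Rightarrow> real) set" where "K = PiE UNIV (\<lambda>_. {0..M})"
  \<comment> \<open>The spectrum is imposed through the values of the characteristic polynomial at
    every \<open>x\<close>, which are continuous in \<open>f\<close>; so \<open>H\<close> is an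
    intersection of closed sets.\<close>
  define H where "H = {f. (\<forall>i. i < n \<longrightarrow> (\<Sum>j<n. f (i, j)) = r f) \<and> (\<forall>j. j < n \<longrightarrow> (\<Sum>i<n. f (i, j)) = r f) \<and>
      (\<forall>x. ?c f x = (x - complex_of_real (r f)) * poly (\<Prod>a\<leftarrow>ls. [:- a, 1:]) x)}"
  have r_cont: "continuous_on S r" for S
    unfolding r_def by (intro continuous_intros continuous_on_coordinate)
  have "closed H"
    unfolding H_def
    by (intro closed_Collect_conj closed_Collect_all closed_Collect_imp closed_Collect_eq open_Collect_const
        continuous_intros continuous_on_coordinate continuous_on_poly_char_poly r_cont)
  then have compact: "compact (K \<inter> H)"
    unfolding K_def by (intro compact_Int_closed compact_function_box)
  have H_iff: "f \<in> H \<longleftrightarrow> equal_sums_mat n (mat n n f) (r f) \<and>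
      spectrum_mset (mat n n f) = mset (complex_of_real (r f) # ls)" for f
  proof -
    have "(\<forall>x. ?c f x = (x - complex_of_real (r f)) * poly (\<Prod>a\<leftarrow>ls. [:- a, 1:]) x)
      \<longleftrightarrow> (\<forall>x. ?c f x = poly (\<Prod>a\<leftarrow>complex_of_real (r f) # ls. [:- a, 1:]) x)"
      by (simp add: algebra_simps)
    also have "\<dots> \<longleftrightarrow> char_poly (complex_mat (mat n n f)) = (\<Prod>a\<leftarrow>complex_of_real (r f) # ls. [:- a, 1:])"
      by (metis poly_ext)
    also have "\<dots> \<longleftrightarrow> spectrum_mset (mat n n f) = mset (complex_of_real (r f) # ls)"
      by (subst spectrum_mset_iff_char_poly[of _ n]) auto
    finally show ?thesis
      unfolding H_def equal_sums_mat_def by auto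
  qed
  have entries: "\<exists>f \<in> K \<inter> H. r f = l" if l: "realizable_equal_sums n ls l" "l \<le> M" for l
  proof -
    obtain A where A: "nonnegative_mat A" "equal_sums_mat n A l" "spectrum_mset A = mset (complex_of_real l # ls)"
      using l by (auto simp: realizable_equal_sums_def)
    \<comment> \<open>The default 0 outside the square stays in the box because
      \<open>0 \<le> M\<close>, shown below from the entry at (0, 0).\<close>
    define f where "f = (\<lambda>(i, j). if i < n \<and> j < n then A $$ (i, j) else 0)"
    have car: "A \<in> carrier_mat n n" and nn: "\<And>i j. i < n \<Longrightarrow> j < n \<Longrightarrow> 0 \<le> A $$ (i, j)"
      and row: "\<And>i. i < n \<Longrightarrow> (\<Sum>j<n. A $$ (i, j)) = l"
      using A by (auto simp: nonnegative_mat_def equal_sums_mat_def)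
    have fA: "mat n n f = A" using car by (intro eq_matI) (auto simp: f_def)
    have rf: "r f = l" using row[OF n] n by (simp add: r_def f_def)
    have le: "A $$ (i, j) \<le> M" if "i < n" "j < n" for i j
    proof -
      have "A $$ (i, j) \<le> (\<Sum>j<n. A $$ (i, j))"
        by (rule member_le_sum) (use that nn in auto)
      then show ?thesis using row that l by auto
    qed
    have "0 \<le> M" using nn[OF n n] le[OF n n] by linarith
    then have "f \<in> K" using nn le by (auto simp: K_def f_def)
    moreover have "f \<in> H" using A by (simp add: H_iff fA rf)
    ultimately show ?thesis using rf by blast
  qed
  then have "K \<inter> H \<noteq> {}" using M by blast
  then obtain f0 where f0: "f0 \<in> K \<inter> H" "\<And>f. f \<in> K \<inter> H \<Longrightarrow> r f0 \<le> r f"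
    using continuous_attains_inf[OF compact _ r_cont] by blast
  have real0: "realizable_equal_sums n ls (r f0)"
    using f0(1) H_iff[of f0] unfolding realizable_equal_sums_def
    by (intro exI[of _ "mat n n f0"]) (auto simp: nonnegative_mat_def K_def)
  have "r f0 \<le> M" using entries[OF M] f0(2) by auto
  moreover have "realizable_equal_sums n ls l \<longleftrightarrow> r f0 \<le> l" for l
  proof
    assume l: "realizable_equal_sums n ls l"
    show "r f0 \<le> l"
    proof (cases "l \<le> M")
      case True
      then show ?thesis using entries[OF l] f0(2) by auto
    qed (use \<open>r f0 \<le> M\<close> in auto)
  qed (use realizable_equal_sums_add[OF real0 n] in blast)
  ultimately show ?thesis using that by blast
qed

text \<open>Listed numbers are eigenvalues and the line sum is the Perron eigenvalue; applied at the
  threshold, this gives its lower bound.\<close>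

lemma realizable_equal_sums_cmod_le:
  assumes "realizable_equal_sums n ls l" "0 < n" "\<mu> \<in> set ls"
  shows "cmod \<mu> \<le> l"
proof -
  obtain A where A: "nonnegative_mat A" "equal_sums_mat n A l" "spectrum_mset A = mset (complex_of_real l # ls)"
    using assms by (auto simp: realizable_equal_sums_def)
  have car: "complex_mat A \<in> carrier_mat n n" using A by (simp add: equal_sums_mat_def)
  have "\<mu> \<in># spectrum_mset A" using A(3) assms(3) by simp
  then have "poly (char_poly (complex_mat A)) \<mu> = 0"
    unfolding spectrum_mset_def using degree_monic_char_poly[OF car]
    by (subst (asm) set_count_proots) auto
  then have "eigenvalue (complex_mat A) \<mu>" using eigenvalue_root_char_poly[OF car] by simp
  then show ?thesis
    using perron_eigenvalue_equal_sums[OF A(2,1) assms(2)] by (simp add: perron_eigenvalue_def)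
qed

section \<open>From the given list to the threshold\<close>

theorem theorem4p2:
  fixes n p :: nat and lam :: "nat \<Rightarrow> complex" and w :: real
  assumes "2 \<le> n"
    and "int n - int p - 1 \<le> int p" and "p \<le> n"
    and closed_cnj:
      "image_mset cnj (mset (map lam [2..<n+1])) = mset (map lam [2..<n+1])"
    and real_part: "\<forall>j\<in>{2..p}. lam j \<in> \<real>"
    and real_decreasing: "\<forall>i\<in>{2..p}. \<forall>j\<in>{2..p}. i \<le> j \<longrightarrow> Re (lam j) \<le> Re (lam i)"
    and nonreal_part: "\<forall>j\<in>{p+1..n}. lam j \<notin> \<real>"
    and pairs:
      "mset (map lam [(n+p) div 2 + 1..<n+1]) =
       image_mset cnj (mset (map lam [p+1..<(n+p) div 2 + 1]))"
    and w_def: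
      "w = Min ((\<Union>j\<in>{2..p}. {Re (lam j), - Re (lam j)}) \<union>
                (\<Union>i\<in>{p+1..(n+p) div 2}.
                   {Re (lam i), - Re (lam i), Im (lam i), - Im (lam i)}))"
  shows
    "let P = (\<lambda>l0 :: real.
               Max ((\<lambda>j. cmod (lam j)) ` {2..n}) \<le> l0 \<and>
               l0 \<le> (real n + 1) * \<bar>w\<bar> \<and>
               (\<forall>l1 :: real.
                  (\<exists>A \<in> carrier_mat n n.
                     gen_doubly_stochastic A \<and> realizes A l1 (map lam [2..<n+1]))
                  \<longleftrightarrow> l0 \<le> l1))
     in \<exists>l0. P l0 \<and> (\<forall>l. P l \<longrightarrow> l0 \<le> l)"
proof -
  define m where "m = (n - p) div 2"
  define ls where "ls = map lam [2..<n+1]"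
  have p: "0 < p" using assms(1,2) by linarith
  \<comment> \<open>Comparing sizes in \<open>pairs\<close> shows that \<open>n + p\<close> is even,
    so the halvings are exact.\<close>
  have diff: "n - (n + p) div 2 = (n + p) div 2 - p"
    using arg_cong[OF pairs, of size] by (simp del: upt_Suc)
  have "p \<le> (n + p) div 2" "(n + p) div 2 \<le> n" using assms(3) by linarith+
  with diff have double: "n + p = 2 * ((n + p) div 2)" "n - p = 2 * ((n + p) div 2 - p)"
    by linarith+
  then have "m = (n + p) div 2 - p" unfolding m_def by simp
  with double \<open>p \<le> (n + p) div 2\<close> have n: "n = p + 2 * m" and half: "(n + p) div 2 = p + m"
    by linarith+
  have "n \<le> 2 * p + 1" using assms(2) by linarith
  \<comment> \<open>If \<open>p = 1\<close>, then \<open>n\<close> is odd and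
    \<open>2 \<le> n \<le> 3\<close>.\<close>
  then have small: "2 \<le> p \<or> n = 3" using assms(1) p n by presburger
  let ?S = "(\<Union>j\<in>{2..p}. {Re (lam j), - Re (lam j)}) \<union>
    (\<Union>i\<in>{p+1..(n+p) div 2}. {Re (lam i), - Re (lam i), Im (lam i), - Im (lam i)})"
  \<comment> \<open>The set is symmetric under negation, so its minimum lies below both a and
    -a.\<close>
  have abs_le: "\<bar>a\<bar> \<le> \<bar>w\<bar>" if "a \<in> ?S" "- a \<in> ?S" for a
  proof -
    have "w \<le> a" "w \<le> - a" using that unfolding w_def by (intro Min_le; blast | simp)+
    then show ?thesis by linarith
  qed
  \<comment> \<open>Slot 0 carries the target Perron value; \<open>lam\<close> starts at index 2, so
    slot 1 holds \<open>lam 2\<close>.\<close>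
  define L where "L k = (if k = 0 then (real n + 1) * \<bar>w\<bar> else Re (lam (k + 1)))" for k
  define Z where "Z r = lam (p + 1 + r)" for r
  have "\<exists>A. nonnegative_mat A \<and> equal_sums_mat n A (L 0) \<and>
    spectrum_mset A = mset (map (\<lambda>k. complex_of_real (L k)) [0..<p]) + mset (map Z [0..<m])
      + mset (map (\<lambda>r. cnj (Z r)) [0..<m])"
  proof (rule exists_realization[OF p n small])
    fix k assume "0 < k" "k < p"
    then have "k + 1 \<in> {2..p}" by auto
    then have "\<bar>Re (lam (k + 1))\<bar> \<le> \<bar>w\<bar>" by (intro abs_le; blast)
    then show "\<bar>L k\<bar> \<le> \<bar>w\<bar>" using \<open>0 < k\<close> by (simp add: L_def)
  next
    fix r assume "r < m"
    then have "p + 1 + r \<in> {p+1..(n+p) div 2}" using half by auto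
    then show "\<bar>Re (Z r)\<bar> \<le> \<bar>w\<bar> \<and> \<bar>Im (Z r)\<bar> \<le> \<bar>w\<bar>"
      unfolding Z_def by (intro conjI abs_le; blast)
  qed (auto simp: L_def)
  moreover have "mset (map (\<lambda>k. complex_of_real (L k)) [0..<p]) + mset (map Z [0..<m])
      + mset (map (\<lambda>r. cnj (Z r)) [0..<m]) = mset (complex_of_real ((real n + 1) * \<bar>w\<bar>) # ls)"
  proof -
    have "map (\<lambda>k. complex_of_real (L k)) [0..<p]
        = complex_of_real ((real n + 1) * \<bar>w\<bar>) # map (\<lambda>k. lam (Suc k)) [1..<p]"
      using p real_part by (auto simp: upt_rec[of 0] L_def)
    also have "map (\<lambda>k. lam (Suc k)) [1..<p] = map lam [2..<p+1]"
      by (simp add: map_Suc_upt[symmetric] numeral_2_eq_2 del: upt_Suc)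
    finally have 1: "map (\<lambda>k. complex_of_real (L k)) [0..<p]
        = complex_of_real ((real n + 1) * \<bar>w\<bar>) # map lam [2..<p+1]" .
    have 2: "map Z [0..<m] = map lam [p+1..<p+m+1]"
      by (rule nth_equalityI) (auto simp: Z_def simp del: upt_Suc)
    have 3: "mset (map (\<lambda>r. cnj (Z r)) [0..<m]) = image_mset cnj (mset (map lam [p+1..<p+m+1]))"
      using arg_cong[OF 2, of "\<lambda>xs. image_mset cnj (mset xs)"] by (simp add: image_mset.compositionality comp_def)
    \<comment> \<open>Real entries, one member of each pair, and the rest, which
      \<open>pairs\<close> identifies with the conjugates of the middle segment.\<close>
    have "[2..<n+1] = [2..<p+1] @ [p+1..<p+m+1] @ [p+m+1..<n+1]"
    proof -
      have "2 \<le> p + 1" "p + 1 \<le> n + 1" "p + 1 \<le> p + m + 1" "p + m + 1 \<le> n + 1"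
        using p n by linarith+
      moreover have "[a..<c] = [a..<b] @ [b..<c]" if "a \<le> b" "b \<le> c" for a b c :: nat
        using upt_add_eq_append[OF that(1), of "c - b"] that(2) by simp
      ultimately show ?thesis by metis
    qed
    then show ?thesis
      unfolding ls_def 1 2 3 using pairs unfolding half by (simp del: upt_Suc)
  qed
  ultimately have "realizable_equal_sums n ls ((real n + 1) * \<bar>w\<bar>)"
    unfolding realizable_equal_sums_def by (auto simp: L_def)
  moreover have n0: "0 < n" using assms(1) by simp
  ultimately obtain l0 where l0: "l0 \<le> (real n + 1) * \<bar>w\<bar>"
      "\<And>l. realizable_equal_sums n ls l \<longleftrightarrow> l0 \<le> l"
    by (rule realizable_equal_sums_least) blast
  have realizable: "(\<exists>A \<in> carrier_mat n n. gen_doubly_stochastic A \<and> realizes A l ls) \<longleftrightarrow> l0 \<le> l" for l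
    unfolding l0(2)[symmetric] realizable_equal_sums_def
    using gen_doubly_stochastic_realizes_iff[OF _ n0] by (metis equal_sums_mat_def)
  have "Max ((\<lambda>j. cmod (lam j)) ` {2..n}) \<le> l0"
    using realizable_equal_sums_cmod_le[OF _ n0, of ls l0] l0(2) assms(1)
    by (subst Max_le_iff) (auto simp: ls_def simp del: upt_Suc)
  \<comment> \<open>The equivalence in \<open>P\<close> determines its argument uniquely, so
    leastness is immediate.\<close>
  then show ?thesis
    unfolding Let_def ls_def[symmetric] realizable using l0(1) by (intro exI[of _ l0]) auto
qed

end
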